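(* The minimum cost of a polysolvable percentage test is $42$.
   Context: A percentage test is a finite nonempty multiset of positive integers (its answers, or options, interpreted as percentages; order is irrelevant). Its cost is the sum of all answers with multiplicity. Let $K$ be the number of options counted with multiplicity, and let $m_a$ be the number of times the value $a$ appears. A value $a$ appearing in the test is a valid answer if $a=\frac{100\,m_a}{K}$. A test is polysolvable if it has more than one distinct valid answer. *)

theory Defs
  imports Complex_Main "HOL-Library.Multiset"
begin

definition percentage_test :: "nat multiset \<Rightarrow> bool" where
  "percentage_test T \<longleftrightarrow> T \<noteq> {#} \<and> (\<forall>a \<in># T. 0 < a)"

definition cost :: "nat multiset \<Rightarrow> nat" where
  "cost T = sum_mset T"

definition valid_answer :: "nat multiset \<Rightarrow> nat \<Rightarrow> bool" where
  "valid_answer T a \<longleftrightarrow>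
     a \<in># T \<and> real a = 100 * real (count T a) / real (size T)"

definition polysolvable :: "nat multiset \<Rightarrow> bool" where
  "polysolvable T \<longleftrightarrow> 1 < card {a. valid_answer T a}"

end

theory Submission
  imports Defs
begin

text \<open>
  Let \<open>a < b\<close> be valid answers of a test with \<open>K\<close> options, let \<open>m\<close> and \<open>n\<close> be their multiplicities,
  and put \<open>x = 100 / K\<close>. Validity says \<open>a = x m\<close> and \<open>b = x n\<close>, so \<open>m < n\<close> and hence \<open>m \<ge> 1\<close>, \<open>n \<ge> 2\<close>.
  Each option costs at least \<open>1\<close>, and the copies of \<open>a\<close> and \<open>b\<close> cost \<open>m (a - 1) + n (b - 1)\<close> on top of
  that, so the cost is at least
  \<open>K + m (a - 1) + n (b - 1) \<ge> K + (x - 1) + 2 (2 x - 1) = K + 5 x - 3\<close>.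
  Since \<open>K x = 100\<close>, the inequality of arithmetic and geometric means gives
  \<open>K + 5 x \<ge> 2 \<surd>500 > 44\<close>. The cost therefore exceeds \<open>41\<close>, and it is an integer.

  The real minimum of \<open>K + 5 x\<close> lies near \<open>K = 22\<close>. With \<open>m = 1\<close> and \<open>n = 2\<close> the answers
  are \<open>x\<close> and \<open>2 x\<close>, so \<open>x\<close> has to be an integer, which suggests the nearby value
  \<open>K = 20\<close>, \<open>x = 5\<close>: one \<open>5\<close>, two \<open>10\<close>s and seventeen \<open>1\<close>s cost exactly \<open>42\<close>.
\<close>

lemma size_le_sum_mset:
  fixes T :: "nat multiset"
  assumes "\<forall>x \<in># T. 0 < x"
  shows "size T \<le> \<Sum>\<^sub># T"
  using assms by (induction T) auto

text \<open>
  Remove all copies of \<open>a\<close> and \<open>b\<close>; every remaining option costs at least \<open>1\<close>. The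
  multiplicities are added on the right to avoid truncated subtraction.
\<close>

lemma sum_mset_ge_two_values:
  fixes T :: "nat multiset"
  assumes pos: "\<forall>x \<in># T. 0 < x" and "a \<noteq> b"
  shows "size T + count T a * a + count T b * b \<le> \<Sum>\<^sub># T + count T a + count T b"
proof -
  let ?S = "replicate_mset (count T a) a + replicate_mset (count T b) b"
  have "?S \<subseteq># T"
    using \<open>a \<noteq> b\<close> by (auto simp: subseteq_mset_def)
  then obtain R where R: "T = ?S + R"
    by (auto simp: mset_subset_eq_exists_conv)
  have "size R \<le> \<Sum>\<^sub># R"
    using pos by (intro size_le_sum_mset) (subst (asm) R, auto)
  moreover have "size T = count T a + count T b + size R"
    by (subst R) simp
  moreover have "\<Sum>\<^sub># T = count T a * a + count T b * b + \<Sum>\<^sub># R"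
    by (subst R) (simp add: sum_mset_replicate_mset)
  ultimately show ?thesis by linarith
qed

lemma polysolvableE:
  assumes "polysolvable T"
  obtains a b where "valid_answer T a" "valid_answer T b" "a < b"
proof -
  have "1 < card {a. valid_answer T a}"
    using assms by (simp add: polysolvable_def)
  then obtain a b where "valid_answer T a" "valid_answer T b" "a \<noteq> b"
    by (metis card_le_Suc0_iff_eq card.infinite mem_Collect_eq not_le One_nat_def zero_le)
  then show thesis
    using that by (cases "a < b") (auto simp: not_less le_less)
qed

text \<open>
  The excess \<open>m (a - 1) + n (b - 1)\<close> is at least its value \<open>5 x - 3\<close> at \<open>m = 1\<close>, \<open>n = 2\<close>, so
  \<open>K + 5 x > 44\<close> suffices. This follows by completing the square: as \<open>K x = 100\<close>, the difference \<open>K + 5 x - 44\<close>, multiplied by \<open>5 x\<close>, equals \<open>(5 x - 22)\<^sup>2 + 16\<close>.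
\<close>

lemma two_valid_values_bound:
  fixes K x m n a b :: real
  assumes "0 < x" and Kx: "K * x = 100"
    and a: "a = x * m" "1 \<le> a" and b: "b = x * n" "1 \<le> b"
    and m: "1 \<le> m" and n: "2 \<le> n"
  shows "41 < K + m * (a - 1) + n * (b - 1)"
proof -
  have "x \<le> a" "2 * x \<le> b"
    using a b m n \<open>0 < x\<close> by (auto simp: mult.commute)
  moreover have "a - 1 \<le> m * (a - 1)" "2 * (b - 1) \<le> n * (b - 1)"
    using mult_right_mono[OF m, of "a - 1"] mult_right_mono[OF n, of "b - 1"] a(2) b(2) by simp_all
  moreover have "44 < K + 5 * x"
  proof -
    have "x * (K + 5 * x - 44) * 5 = (5 * x - 22)\<^sup>2 + 16"
      using Kx by (simp add: power2_eq_square algebra_simps)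
    also have "\<dots> > 0"
      by (simp add: add_nonneg_pos)
    finally show ?thesis
      using \<open>0 < x\<close> by (simp add: zero_less_mult_iff)
  qed
  ultimately show ?thesis by argo
qed

lemma polysolvable_cost_ge:
  assumes T: "percentage_test T" and "polysolvable T"
  shows "42 \<le> cost T"
proof -
  obtain a b where val: "valid_answer T a" "valid_answer T b" and "a < b"
    using \<open>polysolvable T\<close> by (rule polysolvableE)
  define K where "K = size T"
  define x where "x = 100 / real K"
  define m where "m = count T a"
  define n where "n = count T b"
  have pos: "\<forall>y \<in># T. 0 < y" and "0 < K"
    using T by (auto simp: percentage_test_def K_def nonempty_has_size)
  have x: "0 < x" "real K * x = 100"
    using \<open>0 < K\<close> by (auto simp: x_def)
  have ab: "real a = x * real m" "real b = x * real n"
    using val by (auto simp: valid_answer_def x_def m_def n_def K_def)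
  have "1 \<le> a" "1 \<le> b" "1 \<le> m"
    using val pos by (auto simp: valid_answer_def m_def Suc_le_eq)
  moreover have "m < n"
    using \<open>a < b\<close> ab x(1) by (metis mult_less_cancel_left_pos of_nat_less_iff)
  ultimately have "41 < real K + real m * (real a - 1) + real n * (real b - 1)"
    using x ab by (intro two_valid_values_bound) auto
  moreover have "real (K + m * a + n * b) \<le> real (cost T + m + n)"
    unfolding of_nat_le_iff K_def m_def n_def cost_def
    using pos \<open>a < b\<close> by (intro sum_mset_ge_two_values) auto
  ultimately have "41 < real (cost T)"
    by (simp add: algebra_simps)
  then show ?thesis by linarith
qed

lemma polysolvable_test_of_cost_42:
  "\<exists>T. percentage_test T \<and> polysolvable T \<and> cost T = 42"
proof (intro exI conjI)
  let ?T = "{#5#} + replicate_mset 2 10 + replicate_mset 17 1 :: nat multiset"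
  show "percentage_test ?T"
    by (auto simp: percentage_test_def)
  show "cost ?T = 42"
    by (simp add: cost_def sum_mset_replicate_mset)
  have "{a. valid_answer ?T a} \<subseteq> set_mset ?T"
    by (auto simp: valid_answer_def)
  then have "finite {a. valid_answer ?T a}"
    by (rule finite_subset) simp
  moreover have "{5, 10} \<subseteq> {a. valid_answer ?T a}"
    by (auto simp: valid_answer_def)
  ultimately have "card {5, 10 :: nat} \<le> card {a. valid_answer ?T a}"
    by (rule card_mono)
  then show "polysolvable ?T"
    by (simp add: polysolvable_def)
qed

theorem proposition16:
  shows "(\<exists>T. percentage_test T \<and> polysolvable T \<and> cost T = 42) \<and>
         (\<forall>T. percentage_test T \<and> polysolvable T \<longrightarrow> 42 \<le> cost T)"
  using polysolvable_test_of_cost_42 polysolvable_cost_ge by blast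

end
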